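(* Let $S\subseteq\mathbb N^2$ be a (local) good semigroup with projections $S_1,S_2\subseteq\mathbb N$ on the two coordinates, let $\boldsymbol e=(e_1,e_2)$ be its minimal nonzero element, $e=e_1+e_2$, and let $\mathrm{Ap}(S)=\bigcup_{i=1}^e A_i$ be the partition of the Apéry set into levels. Assume $e_1\ge e_2$. Then: (1) each of the levels $A_e,A_{e-1},\dots,A_{e-e_2+1}$ contains two infinite lines; (2) each of the levels $A_{e-e_2},\dots,A_{e-e_1+1}$ contains only one infinite line, and it is of the form $\Delta_1(s_1,r)$ corresponding to some element $s_1\in S_1$; (3) the levels $A_{e-e_1},\dots,A_2,A_1$ are finite. If $e_1\le e_2$, the corresponding analogous statements hold: $A_e,\dots,A_{e-e_1+1}$ contain two infinite lines; $A_{e-e_1},\dots,A_{e-e_2+1}$ contain only one infinite line, of the form $\Delta_2(q,s_2)$ with $s_2\in S_2$; and $A_{e-e_2},\dots,A_1$ are finite.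
   Context: $\mathbb N$ is the set of nonnegative integers. On $\mathbb Z^2$, $\alpha\le\beta$ is the componentwise order; $\alpha\wedge\beta$ is the componentwise minimum; $\alpha\ll\beta$ means $\alpha_1<\beta_1$ and $\alpha_2<\beta_2$; $\alpha\le\le\beta$ means $\alpha=\beta$ or $\alpha\ll\beta$. A good semigroup is a submonoid $S$ of $(\mathbb N^2,+)$ such that: (G1) $\alpha,\beta\in S\Rightarrow\alpha\wedge\beta\in S$; (G2) if $\alpha,\beta\in S$ and $\alpha_i=\beta_i$ for some $i\in\{1,2\}$, where $j$ is the other index, then there is $\delta\in S$ with $\delta_i>\alpha_i=\beta_i$, $\delta_j\ge\min\{\alpha_j,\beta_j\}$, and $\delta_j=\min\{\alpha_j,\beta_j\}$ if $\alpha_j\neq\beta_j$; (G3) there is $c\in S$ with $c+\mathbb N^2\subseteq S$. All good semigroups are assumed local: $(0,0)$ is the only element of $S$ with a zero component. Then $S\setminus\{(0,0)\}$ has a minimum with respect to $\le$, denoted $\boldsymbol e=(e_1,e_2)$. The Apéry set is $\mathrm{Ap}(S)=\{\alpha\in S:\alpha-\boldsymbol e\notin S\}$. Levels: for $i\ge1$, having defined $D^{(1)},\dots,D^{(i-1)}$, let $B^{(i)}$ be the set of elements of $\mathrm{Ap}(S)\setminus\bigcup_{j<i}D^{(j)}$ maximal in it with respect to $\le\le$, let $C^{(i)}=\{\alpha\in B^{(i)}:\alpha=\beta_1\wedge\beta_2\text{ for some }\beta_1,\beta_2\in B^{(i)}\setminus\{\alpha\}\}$, and $D^{(i)}=B^{(i)}\setminus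 C^{(i)}$. For some least $N$, $\mathrm{Ap}(S)$ is the disjoint union of $D^{(1)},\dots,D^{(N)}$, and $A_i=D^{(N+1-i)}$. It is a fact that $N=e_1+e_2$; this number is denoted $e$. Infinite lines: $\Delta_1(a,b)=\{(a,y)\in\mathbb Z^2:y>b\}$ and $\Delta_2(a,b)=\{(x,b)\in\mathbb Z^2:x>a\}$. For $s_1\in S_1$, $\Delta_1(s_1,r)$ is an infinite line of $\mathrm{Ap}(S)$ if $r\in S_2$ and $\Delta_1(s_1,r)\subseteq\mathrm{Ap}(S)$; for $s_2\in S_2$, $\Delta_2(q,s_2)$ is an infinite line of $\mathrm{Ap}(S)$ if $q\in S_1$ and $\Delta_2(q,s_2)\subseteq\mathrm{Ap}(S)$. A level $A_i$ contains two infinite lines if there exist $s_1\in S_1$, $s_2\in S_2$, $q\in S_1$, $r\in S_2$ such that $\Delta_1(s_1,r)$ and $\Delta_2(q,s_2)$ are infinite lines of $\mathrm{Ap}(S)$ contained in $A_i$. It contains only one infinite line if exactly one of these two conditions (existence of such a $\Delta_1(s_1,r)\subseteq A_i$; existence of such a $\Delta_2(q,s_2)\subseteq A_i$) holds. It is finite if it has finitely many elements. Empty ranges of indices are allowed. *)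

theory Defs
  imports Main "HOL-Library.Product_Plus" "HOL-Library.Product_Order" "HOL-Library.Disjoint_Sets"
begin

text \<open>
  Elements of \<open>\<nat>\<^sup>2\<close> are pairs of type \<open>nat \<times> nat\<close>. With the imported instances, \<open>0\<close>, \<open>+\<close> and \<open>-\<close>
  are componentwise, \<open>\<le>\<close> is the componentwise order and \<open>inf \<alpha> \<beta>\<close> is the componentwise
  minimum \<open>\<alpha> \<and> \<beta>\<close>.
\<close>

definition ll :: "nat \<times> nat \<Rightarrow> nat \<times> nat \<Rightarrow> bool" where
  "ll \<alpha> \<beta> \<longleftrightarrow> fst \<alpha> < fst \<beta> \<and> snd \<alpha> < snd \<beta>"

definition lele :: "nat \<times> nat \<Rightarrow> nat \<times> nat \<Rightarrow> bool" where
  "lele \<alpha> \<beta> \<longleftrightarrow> \<alpha> = \<beta> \<or> ll \<alpha> \<beta>"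

locale good_semigroup =
  fixes S :: "(nat \<times> nat) set"
  assumes zero_mem: "0 \<in> S"
    and add_mem: "\<lbrakk>\<alpha> \<in> S; \<beta> \<in> S\<rbrakk> \<Longrightarrow> \<alpha> + \<beta> \<in> S"
    and G1: "\<lbrakk>\<alpha> \<in> S; \<beta> \<in> S\<rbrakk> \<Longrightarrow> inf \<alpha> \<beta> \<in> S"
    and G2_fst: "\<lbrakk>\<alpha> \<in> S; \<beta> \<in> S; fst \<alpha> = fst \<beta>\<rbrakk> \<Longrightarrow>
      \<exists>\<delta>\<in>S. fst \<delta> > fst \<alpha> \<and> snd \<delta> \<ge> min (snd \<alpha>) (snd \<beta>) \<and>
        (snd \<alpha> \<noteq> snd \<beta> \<longrightarrow> snd \<delta> = min (snd \<alpha>) (snd \<beta>))"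
    and G2_snd: "\<lbrakk>\<alpha> \<in> S; \<beta> \<in> S; snd \<alpha> = snd \<beta>\<rbrakk> \<Longrightarrow>
      \<exists>\<delta>\<in>S. snd \<delta> > snd \<alpha> \<and> fst \<delta> \<ge> min (fst \<alpha>) (fst \<beta>) \<and>
        (fst \<alpha> \<noteq> fst \<beta> \<longrightarrow> fst \<delta> = min (fst \<alpha>) (fst \<beta>))"
    and G3: "\<exists>c\<in>S. \<forall>\<gamma>. c + \<gamma> \<in> S"

locale local_good_semigroup = good_semigroup +
  assumes local: "\<lbrakk>\<alpha> \<in> S; fst \<alpha> = 0 \<or> snd \<alpha> = 0\<rbrakk> \<Longrightarrow> \<alpha> = 0"

text \<open>The minimum of \<open>S \<setminus> {0}\<close> for the componentwise order, i.e. an element below all others.\<close>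

definition min_vec :: "(nat \<times> nat) set \<Rightarrow> nat \<times> nat" where
  "min_vec S = (LEAST \<alpha>. \<alpha> \<in> S - {0})"

text \<open>
  The difference \<open>\<alpha> - e\<close> is meant in \<open>\<int>\<^sup>2\<close>, where it lies outside \<open>\<nat>\<^sup>2 \<supseteq> S\<close> unless \<open>e \<le> \<alpha>\<close>;
  the guard excludes the truncated difference of natural numbers.
\<close>

definition Apery :: "(nat \<times> nat) set \<Rightarrow> (nat \<times> nat) set" where
  "Apery S = {\<alpha> \<in> S. \<not> (min_vec S \<le> \<alpha> \<and> \<alpha> - min_vec S \<in> S)}"

text \<open>
  \<open>B_part X\<close>, \<open>C_part X\<close> and \<open>D_part X\<close> are \<open>B\<^sup>(\<^sup>i\<^sup>)\<close>, \<open>C\<^sup>(\<^sup>i\<^sup>)\<close> and \<open>D\<^sup>(\<^sup>i\<^sup>)\<close>, where \<open>X\<close> is what is left of the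
  Apery set after removing \<open>D\<^sup>(\<^sup>j\<^sup>)\<close> for \<open>1 \<le> j < i\<close>.
\<close>

definition B_part :: "(nat \<times> nat) set \<Rightarrow> (nat \<times> nat) set" where
  "B_part X = {\<alpha> \<in> X. \<forall>\<beta>\<in>X. lele \<alpha> \<beta> \<longrightarrow> \<beta> = \<alpha>}"

definition C_part :: "(nat \<times> nat) set \<Rightarrow> (nat \<times> nat) set" where
  "C_part X = {\<alpha> \<in> B_part X. \<exists>\<beta>\<^sub>1 \<in> B_part X - {\<alpha>}. \<exists>\<beta>\<^sub>2 \<in> B_part X - {\<alpha>}. \<alpha> = inf \<beta>\<^sub>1 \<beta>\<^sub>2}"

definition D_part :: "(nat \<times> nat) set \<Rightarrow> (nat \<times> nat) set" where
  "D_part X = B_part X - C_part X"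

text \<open>\<open>D_level S i\<close> is \<open>D\<^sup>(\<^sup>i\<^sup>)\<close> for \<open>i \<ge> 1\<close>; its value at \<open>i = 0\<close> is never used.\<close>

function D_level :: "(nat \<times> nat) set \<Rightarrow> nat \<Rightarrow> (nat \<times> nat) set" where
  "D_level S i = D_part (Apery S - (\<Union>j\<in>{1..<i}. D_level S j))"
  by pat_completeness auto
termination
  by (relation "Wellfounded.measure snd") auto

declare D_level.simps [simp del]

definition num_levels :: "(nat \<times> nat) set \<Rightarrow> nat" where
  "num_levels S = (LEAST N. disjoint_family_on (D_level S) {1..N} \<and>
                            Apery S = (\<Union>i\<in>{1..N}. D_level S i))"

definition A_level :: "(nat \<times> nat) set \<Rightarrow> nat \<Rightarrow> (nat \<times> nat) set" where
  "A_level S i = D_level S (num_levels S + 1 - i)"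

definition Delta1 :: "nat \<Rightarrow> nat \<Rightarrow> (nat \<times> nat) set" where
  "Delta1 a b = {(a, y) | y. y > b}"

definition Delta2 :: "nat \<Rightarrow> nat \<Rightarrow> (nat \<times> nat) set" where
  "Delta2 a b = {(x, b) | x. x > a}"

text \<open>The projections of \<open>S\<close> on the coordinates are \<open>fst ` S\<close> and \<open>snd ` S\<close>.\<close>

definition infinite_line1 :: "(nat \<times> nat) set \<Rightarrow> nat \<Rightarrow> nat \<Rightarrow> bool" where
  "infinite_line1 S s\<^sub>1 r \<longleftrightarrow> s\<^sub>1 \<in> fst ` S \<and> r \<in> snd ` S \<and> Delta1 s\<^sub>1 r \<subseteq> Apery S"

definition infinite_line2 :: "(nat \<times> nat) set \<Rightarrow> nat \<Rightarrow> nat \<Rightarrow> bool" where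
  "infinite_line2 S q s\<^sub>2 \<longleftrightarrow> q \<in> fst ` S \<and> s\<^sub>2 \<in> snd ` S \<and> Delta2 q s\<^sub>2 \<subseteq> Apery S"

definition contains_line1 :: "(nat \<times> nat) set \<Rightarrow> (nat \<times> nat) set \<Rightarrow> bool" where
  "contains_line1 S X \<longleftrightarrow> (\<exists>s\<^sub>1 r. infinite_line1 S s\<^sub>1 r \<and> Delta1 s\<^sub>1 r \<subseteq> X)"

definition contains_line2 :: "(nat \<times> nat) set \<Rightarrow> (nat \<times> nat) set \<Rightarrow> bool" where
  "contains_line2 S X \<longleftrightarrow> (\<exists>q s\<^sub>2. infinite_line2 S q s\<^sub>2 \<and> Delta2 q s\<^sub>2 \<subseteq> X)"

definition contains_two_infinite_lines :: "(nat \<times> nat) set \<Rightarrow> (nat \<times> nat) set \<Rightarrow> bool" where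
  "contains_two_infinite_lines S X \<longleftrightarrow> contains_line1 S X \<and> contains_line2 S X"

definition contains_only_one_infinite_line :: "(nat \<times> nat) set \<Rightarrow> (nat \<times> nat) set \<Rightarrow> bool" where
  "contains_only_one_infinite_line S X \<longleftrightarrow>
     (contains_line1 S X \<and> \<not> contains_line2 S X) \<or> (\<not> contains_line1 S X \<and> contains_line2 S X)"

end

theory Submission
  imports Defs
begin

text \<open>
  Let \<open>E = \<^bold>e + S\<close>, so that the Apery set is \<open>S - E\<close>. For a good set \<open>X\<close> the number of steps of a
  saturated chain of \<open>X\<close> below a point \<open>p\<close> does not depend on the chain; let \<open>rank p\<close> be this number
  for \<open>S\<close> minus the one for \<open>E\<close>. A unit step from \<open>p\<close> in one direction raises the rank by one
  if the closed ray from \<open>p\<close> in the other direction meets \<open>S\<close> but not \<open>E\<close>, and leaves it unchanged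
  otherwise. As \<open>E\<close> is closed under minima, at most one of the two rays from a point outside \<open>E\<close>
  meets \<open>E\<close>, and this is what identifies \<open>A\<^sub>i\<close> with the set of Apery elements of rank \<open>i - 1\<close>.
  The rank is \<open>0\<close> at the origin, \<open>e\<^sub>2\<close> far up on the first column, \<open>e\<^sub>1\<close> far right on the first
  row, and \<open>e\<^sub>1 + e\<^sub>2\<close> beyond the conductor of \<open>E\<close>. On a row beyond that conductor it therefore climbs
  from \<open>e\<^sub>2\<close> to \<open>e\<^sub>1 + e\<^sub>2\<close> in unit steps, each of which is an infinite vertical line of the Apery set.
\<close>

section \<open>Chain lengths in good sets\<close>

definition hits_col :: "(nat \<times> nat) set \<Rightarrow> nat \<Rightarrow> nat \<Rightarrow> bool" where
  "hits_col X x y \<longleftrightarrow> (\<exists>t\<ge>y. (x, t) \<in> X)"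

definition hits_row :: "(nat \<times> nat) set \<Rightarrow> nat \<Rightarrow> nat \<Rightarrow> bool" where
  "hits_row X x y \<longleftrightarrow> (\<exists>t\<ge>x. (t, y) \<in> X)"

lemma hits_swap [simp]:
  "hits_col (prod.swap ` X) x y = hits_row X y x"
  "hits_row (prod.swap ` X) x y = hits_col X y x"
  by (simp_all add: hits_col_def hits_row_def)

lemma hits_col_Suc: "hits_col X x y \<longleftrightarrow> (x, y) \<in> X \<or> hits_col X x (Suc y)"
  unfolding hits_col_def Suc_le_eq by (auto simp: le_eq_less_or_eq)

lemma hits_row_Suc: "hits_row X x y \<longleftrightarrow> (x, y) \<in> X \<or> hits_row X (Suc x) y"
  unfolding hits_row_def Suc_le_eq by (auto simp: le_eq_less_or_eq)

text \<open>
  The number of steps of a saturated chain of \<open>X\<close> below \<open>(x, y)\<close>, counted along the lattice path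
  that first runs along the bottom row and then up the column \<open>x\<close>.
\<close>

definition len :: "(nat \<times> nat) set \<Rightarrow> nat \<Rightarrow> nat \<Rightarrow> nat" where
  "len X x y = card {i. i < x \<and> hits_col X i 0} + card {j. j < y \<and> hits_row X x j}"

lemma card_less_Suc_conj:
  "card {i. i < Suc n \<and> P i} = card {i. i < n \<and> P i} + of_bool (P n)"
proof -
  have "{i. i < Suc n \<and> P i} = (if P n then insert n {i. i < n \<and> P i} else {i. i < n \<and> P i})"
    by (auto simp: less_Suc_eq)
  then show ?thesis by simp
qed

lemma len_0 [simp]: "len X 0 0 = 0"
  by (simp add: len_def)

lemma len_Suc_snd: "len X x (Suc y) = len X x y + of_bool (hits_row X x y)"
  unfolding len_def card_less_Suc_conj by simp

text \<open>Unlike being a submonoid, these conditions pass to the translate \<open>E\<close>.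
  Together they are symmetric under exchanging the coordinates.\<close>

locale good_set =
  fixes X :: "(nat \<times> nat) set"
  assumes min_mem: "\<lbrakk>(a, b) \<in> X; (a', b') \<in> X\<rbrakk> \<Longrightarrow> (min a a', min b b') \<in> X"
    and right_of: "\<lbrakk>(a, b) \<in> X; (a, b') \<in> X; b < b'\<rbrakk> \<Longrightarrow> \<exists>a'>a. (a', b) \<in> X"
    and above_of: "\<lbrakk>(a, b) \<in> X; (a', b) \<in> X; a < a'\<rbrakk> \<Longrightarrow> \<exists>b'>b. (a, b') \<in> X"
begin

lemma good_set_swap: "good_set (prod.swap ` X)"
  by unfold_locales (simp_all add: min_mem right_of above_of)

text \<open>\<open>(x, y)\<close> is the minimum of a point of \<open>X\<close> on the vertical ray
  and one on the horizontal ray.\<close>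

lemma mem_if_hits: "hits_col X x y \<Longrightarrow> hits_row X x y \<Longrightarrow> (x, y) \<in> X"
  unfolding hits_col_def hits_row_def using min_mem by (metis min.absorb1 min.absorb2)

text \<open>Both lattice paths around a unit square count the same number of steps.\<close>

lemma hits_exchange:
  "(of_bool (hits_col X x y) + of_bool (hits_row X (Suc x) y) :: nat) =
   of_bool (hits_row X x y) + of_bool (hits_col X x (Suc y))"
\<comment> \<open>At a point of \<open>X\<close> both closed rays count, and the (G2) conditions
  make the two open rays meet \<open>X\<close> together. Elsewhere a closed ray meets
  \<open>X\<close> exactly when the open one does.\<close>
proof (cases "(x, y) \<in> X")
  case True
  then have "hits_row X (Suc x) y \<longleftrightarrow> hits_col X x (Suc y)"
    unfolding hits_row_def hits_col_def using right_of above_of by (meson Suc_le_eq)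
  with True show ?thesis by (simp add: hits_col_Suc[of X x y] hits_row_Suc[of X x y])
next
  case False
  then show ?thesis by (simp add: hits_col_Suc[of X x y] hits_row_Suc[of X x y])
qed

text \<open>The path in \<open>len\<close> goes right first; \<open>hits_exchange\<close> lifts the
  extra horizontal step from the bottom row to height \<open>y\<close>, one square at a
  time.\<close>

lemma len_Suc_fst: "len X (Suc x) y = len X x y + of_bool (hits_col X x y)"
proof (induction y)
  case 0
  show ?case unfolding len_def card_less_Suc_conj by simp
next
  case (Suc y)
  then show ?case using hits_exchange[of x y] by (simp only: len_Suc_snd)
qed

text \<open>Both sides vanish at the origin and obey the same unit-step recurrences. This lets every
  statement about rows yield its mirror image about columns.\<close>

lemma len_swap: "len (prod.swap ` X) y x = len X x y"
proof -
  interpret sw: good_set "prod.swap ` X" by (rule good_set_swap)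
  have "len (prod.swap ` X) y 0 = len X 0 y"
    by (induction y) (simp_all add: sw.len_Suc_fst len_Suc_snd)
  then show ?thesis
    by (induction x) (simp_all add: len_Suc_fst len_Suc_snd)
qed

end

section \<open>The rank function\<close>

locale apery_pair = good_set S for S :: "(nat \<times> nat) set" +
  fixes e1 e2 c1 c2 :: nat
  assumes shift_mem: "(a, b) \<in> S \<Longrightarrow> (e1 + a, e2 + b) \<in> S"
    and beyond_mem: "c1 \<le> a \<Longrightarrow> c2 \<le> b \<Longrightarrow> (a, b) \<in> S"
begin

definition E :: "(nat \<times> nat) set" where
  "E = {(e1 + a, e2 + b) |a b. (a, b) \<in> S}"

text \<open>The subtraction never truncates, by \<open>len_E_le\<close>.\<close>

definition rank :: "nat \<Rightarrow> nat \<Rightarrow> nat" where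
  "rank x y = len S x y - len E x y"

definition gap_col :: "nat \<Rightarrow> nat \<Rightarrow> bool" where
  "gap_col x y \<longleftrightarrow> hits_col S x y \<and> \<not> hits_col E x y"

definition gap_row :: "nat \<Rightarrow> nat \<Rightarrow> bool" where
  "gap_row x y \<longleftrightarrow> hits_row S x y \<and> \<not> hits_row E x y"

lemma shifted_mem_E: "(e1 + a, e2 + b) \<in> E \<longleftrightarrow> (a, b) \<in> S"
  by (auto simp: E_def)

lemma E_ge: "(a, b) \<in> E \<Longrightarrow> e1 \<le> a \<and> e2 \<le> b"
  by (auto simp: E_def)

lemma E_subset: "E \<subseteq> S"
  using shift_mem by (auto simp: E_def)

sublocale E: good_set E
proof
  fix a b a' b'
  assume "(a, b) \<in> E" "(a', b') \<in> E"
  then show "(min a a', min b b') \<in> E"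
    by (auto simp: E_def min_add_distrib_right[symmetric] dest: min_mem)
next
  fix a b b'
  assume "(a, b) \<in> E" "(a, b') \<in> E" "b < b'"
  then obtain u v v' where "a = e1 + u" "b = e2 + v" "(u, v) \<in> S" "(u, v') \<in> S" "v < v'"
    by (auto simp: E_def)
  then obtain u' where "u' > u" "(u', v) \<in> S" using right_of by blast
  then show "\<exists>a'>a. (a', b) \<in> E"
    using \<open>a = _\<close> \<open>b = _\<close> shifted_mem_E by (metis add_less_cancel_left)
next
  fix a b a'
  assume "(a, b) \<in> E" "(a', b) \<in> E" "a < a'"
  then obtain u v u' where "a = e1 + u" "b = e2 + v" "(u, v) \<in> S" "(u', v) \<in> S" "u < u'"
    by (auto simp: E_def)
  then obtain v' where "v' > v" "(u, v') \<in> S" using above_of by blast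
  then show "\<exists>b'>b. (a, b') \<in> E"
    using \<open>a = _\<close> \<open>b = _\<close> shifted_mem_E by (metis add_less_cancel_left)
qed

lemma apery_pair_swap: "apery_pair (prod.swap ` S) e2 e1 c2 c1"
proof -
  interpret sw: good_set "prod.swap ` S" by (rule good_set_swap)
  show ?thesis by unfold_locales (simp_all add: shift_mem beyond_mem)
qed

lemma swap_E: "apery_pair.E (prod.swap ` S) e2 e1 = prod.swap ` E"
proof -
  interpret sw: apery_pair "prod.swap ` S" e2 e1 c2 c1 by (rule apery_pair_swap)
  show ?thesis by (force simp: sw.E_def E_def)
qed

lemma swap_rank: "apery_pair.rank (prod.swap ` S) e2 e1 y x = rank x y"
proof -
  interpret sw: apery_pair "prod.swap ` S" e2 e1 c2 c1 by (rule apery_pair_swap)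
  show ?thesis by (simp add: sw.rank_def rank_def swap_E len_swap E.len_swap)
qed

lemma swap_gap_row: "apery_pair.gap_row (prod.swap ` S) e2 e1 y x = gap_col x y"
proof -
  interpret sw: apery_pair "prod.swap ` S" e2 e1 c2 c1 by (rule apery_pair_swap)
  show ?thesis by (simp add: sw.gap_row_def gap_col_def swap_E)
qed

lemma hits_col_E: "hits_col E x y \<Longrightarrow> hits_col S x y"
  using E_subset by (auto simp: hits_col_def)

lemma hits_row_E: "hits_row E x y \<Longrightarrow> hits_row S x y"
  using E_subset by (auto simp: hits_row_def)

lemma len_E_le: "len E x y \<le> len S x y"
  unfolding len_def by (intro add_mono card_mono) (auto dest: hits_col_E hits_row_E)

lemma rank_Suc_fst: "rank (Suc x) y = rank x y + of_bool (gap_col x y)"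
  using len_E_le[of x y] hits_col_E[of x y]
  by (auto simp: rank_def len_Suc_fst E.len_Suc_fst gap_col_def)

lemma rank_Suc_snd: "rank x (Suc y) = rank x y + of_bool (gap_row x y)"
  using len_E_le[of x y] hits_row_E[of x y]
  by (auto simp: rank_def len_Suc_snd gap_row_def)

lemma rank_mono: "x \<le> x' \<Longrightarrow> y \<le> y' \<Longrightarrow> rank x y \<le> rank x' y'"
proof -
  assume "x \<le> x'" "y \<le> y'"
  have "rank x y \<le> rank x' y"
    by (rule lift_Suc_mono_le[OF _ \<open>x \<le> x'\<close>]) (simp add: rank_Suc_fst)
  also have "\<dots> \<le> rank x' y'"
    by (rule lift_Suc_mono_le[OF _ \<open>y \<le> y'\<close>]) (simp add: rank_Suc_snd)
  finally show ?thesis .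
qed

lemma rank_0 [simp]: "rank 0 0 = 0"
  by (simp add: rank_def)

lemma hits_E_shift:
  "hits_col E (e1 + x) (e2 + y) = hits_col S x y"
  "hits_row E 0 (e2 + y) = hits_row S 0 y"
  "x < e1 \<Longrightarrow> \<not> hits_col E x y'"
  "y < e2 \<Longrightarrow> \<not> hits_row E x' y"
proof -
  show "hits_col E (e1 + x) (e2 + y) = hits_col S x y"
    unfolding hits_col_def
  proof
    assume "\<exists>t\<ge>e2 + y. (e1 + x, t) \<in> E"
    then obtain t where "e2 + y \<le> t" "(e1 + x, t) \<in> E" by blast
    then show "\<exists>t\<ge>y. (x, t) \<in> S"
      using shifted_mem_E[of x "t - e2"] by (intro exI[of _ "t - e2"]) auto
  qed (metis shifted_mem_E add_le_cancel_left)
  show "hits_row E 0 (e2 + y) = hits_row S 0 y"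
    unfolding hits_row_def
  proof
    assume "\<exists>t\<ge>0. (t, e2 + y) \<in> E"
    then obtain t where "(t, e2 + y) \<in> E" by blast
    then show "\<exists>t\<ge>0. (t, y) \<in> S"
      using shifted_mem_E[of "t - e1" y] E_ge[of t "e2 + y"] by (intro exI[of _ "t - e1"]) auto
  qed (metis shifted_mem_E le0)
qed (use E_ge in \<open>force simp: hits_col_def hits_row_def\<close>)+

lemma len_E_shift_0: "len E 0 (e2 + y) = len S 0 y"
proof (induction y)
  case 0
  have "y \<le> e2 \<Longrightarrow> len E 0 y = 0" for y
    by (induction y) (simp_all add: len_Suc_snd hits_E_shift)
  then show ?case by simp
next
  case (Suc y)
  then show ?case by (simp add: len_Suc_snd hits_E_shift)
qed

text \<open>Go up the first column, then right: the first \<open>e2\<close> rows and the first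
  \<open>e1\<close> columns miss \<open>E\<close>, and the remaining steps match those of
  \<open>S\<close>, translated.\<close>

lemma len_E_shift: "len E (e1 + x) (e2 + y) = len S x y"
proof (induction x)
  case 0
  have "x \<le> e1 \<Longrightarrow> len E x (e2 + y) = len S 0 y" for x
    by (induction x) (simp_all add: E.len_Suc_fst hits_E_shift len_E_shift_0)
  then show ?case by simp
next
  case (Suc x)
  then show ?case by (simp add: E.len_Suc_fst len_Suc_fst hits_E_shift)
qed

lemma hits_row_beyond: "c2 \<le> y \<Longrightarrow> hits_row S x y"
  unfolding hits_row_def by (meson beyond_mem nat_le_linear)

lemma hits_col_beyond: "c1 \<le> x \<Longrightarrow> hits_col S x y"
  unfolding hits_col_def by (meson beyond_mem nat_le_linear)

lemma hits_row_E_beyond: "c2 + e2 \<le> y \<Longrightarrow> hits_row E x y"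
proof -
  assume y: "c2 + e2 \<le> y"
  have "(e1 + (c1 + x), e2 + (y - e2)) \<in> E"
    unfolding shifted_mem_E using y by (intro beyond_mem) auto
  with y show ?thesis unfolding hits_row_def by (intro exI[of _ "e1 + (c1 + x)"]) auto
qed

lemma len_beyond_snd: "c2 \<le> y \<Longrightarrow> len S x (y + n) = len S x y + n"
  by (induction n) (simp_all add: len_Suc_snd hits_row_beyond)

lemma len_beyond_fst: "c1 \<le> x \<Longrightarrow> len S (x + n) y = len S x y + n"
  by (induction n) (simp_all add: len_Suc_fst hits_col_beyond)

text \<open>\<open>E\<close> counts here what \<open>S\<close> counts at \<open>(c1, c2)\<close>,
  and past that point each of the \<open>e1 + e2\<close> further steps counts for
  \<open>S\<close>.\<close>

lemma rank_beyond: "rank (c1 + e1) (c2 + e2) = e1 + e2"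
  using len_E_shift[of c1 c2]
  by (simp add: rank_def len_beyond_fst len_beyond_snd add.commute)

lemma rank_first_col: "rank 0 (c2 + e2) = e2"
  using len_E_shift_0[of c2] by (simp add: rank_def len_beyond_snd add.commute)

lemma rank_first_row: "rank (c1 + e1) 0 = e1"
  using apery_pair.rank_first_col[OF apery_pair_swap] by (simp add: swap_rank)

lemma rank_row_beyond: "c2 + e2 \<le> y \<Longrightarrow> rank x y = rank x (c2 + e2)"
  by (induction y rule: dec_induct) (simp_all add: rank_Suc_snd gap_row_def hits_row_E_beyond)

section \<open>The rank on the Apery set\<close>

text \<open>Both rays from an element of \<open>S\<close> meet \<open>S\<close>; if both met
  \<open>E\<close>, their minimum \<open>(x, y)\<close> would lie in \<open>E\<close>.\<close>

lemma gap_if_apery: "(x, y) \<in> S - E \<Longrightarrow> gap_col x y \<or> gap_row x y"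
  unfolding gap_col_def gap_row_def
  using E.mem_if_hits hits_col_Suc[of S x y] hits_row_Suc[of S x y] by blast

lemma rank_less:
  assumes "(x, y) \<in> S - E" "x < x'" "y < y'"
  shows "rank x y < rank x' y'"
proof -
  have "rank (Suc x) y \<le> rank x' y'" "rank x (Suc y) \<le> rank x' y'"
    using assms by (auto intro: rank_mono)
  then show ?thesis
    using gap_if_apery[OF assms(1)] by (auto simp: rank_Suc_fst rank_Suc_snd)
qed

text \<open>
  The witness is the first element of \<open>S\<close> on the ray: any element of \<open>S\<close> above a point strictly
  before it would, by minimality of the witness and closure under minima, give an earlier one.
\<close>

lemma gap_row_apery:
  assumes "gap_row x y"
  shows "\<exists>t\<ge>x. (t, y) \<in> S - E \<and> rank t y = rank x y"
proof -
  define t where "t = (LEAST t. x \<le> t \<and> (t, y) \<in> S)"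
  have "\<exists>t. x \<le> t \<and> (t, y) \<in> S" using assms by (auto simp: gap_row_def hits_row_def)
  then have t: "x \<le> t" "(t, y) \<in> S"
    unfolding t_def by (metis (mono_tags, lifting) LeastI_ex)+
  have no: "(i, y) \<notin> S" if "x \<le> i" "i < t" for i
    using not_less_Least[OF that(2)[unfolded t_def]] that(1) by blast
  have no_gap: "\<not> gap_col i y" if i: "x \<le> i" "i < t" for i
  proof
    assume "gap_col i y"
    then have "hits_col S i y" by (simp add: gap_col_def)
    moreover have "hits_row S i y" using t(2) less_imp_le[OF i(2)] by (auto simp: hits_row_def)
    ultimately show False using mem_if_hits no[OF i] by blast
  qed
  have const: "rank i y = rank x y" if "x \<le> i" "i \<le> t" for i
    using that by (induction i rule: dec_induct) (simp_all add: rank_Suc_fst no_gap)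
  have "(t, y) \<notin> E" using assms t by (auto simp: gap_row_def hits_row_def)
  with t const[OF t(1) order_refl] show ?thesis by blast
qed

lemma gap_col_apery:
  assumes "gap_col x y"
  shows "\<exists>t\<ge>y. (x, t) \<in> S - E \<and> rank x t = rank x y"
proof -
  interpret sw: apery_pair "prod.swap ` S" e2 e1 c2 c1 by (rule apery_pair_swap)
  show ?thesis using sw.gap_row_apery[of y x] assms
    by (simp add: swap_gap_row swap_rank swap_E)
qed

lemma unit_step_crossing:
  fixes f :: "nat \<Rightarrow> nat"
  assumes "f m \<le> k" "k < f n" "m \<le> n" "\<And>i. f (Suc i) = f i + of_bool (P i)"
  shows "\<exists>i\<ge>m. P i \<and> f i = k"
  using \<open>m \<le> n\<close> \<open>k < f n\<close>
proof (induction n rule: dec_induct)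
  case base
  with \<open>f m \<le> k\<close> show ?case by simp
next
  case (step n)
  show ?case
  proof (cases "k < f n")
    case True
    with step show ?thesis by blast
  next
    case False
    with step assms(4)[of n] have "P n" "f n = k" by (auto split: if_splits simp: of_bool_def)
    with step show ?thesis by blast
  qed
qed

lemma apery_of_rank:
  assumes "rank x y \<le> k" "k < e1 + e2"
  shows "\<exists>x'\<ge>x. \<exists>y'\<ge>y. (x', y') \<in> S - E \<and> rank x' y' = k"
proof -
  \<comment> \<open>Walk right along row \<open>y\<close> to column \<open>X\<close>, then up to
    \<open>(X, Y)\<close>, where the rank is at least \<open>e1 + e2\<close>. The step at which the
    rank leaves \<open>k\<close> is a gap, and its ray carries an Apery element of the same
    rank.\<close>
  define X where "X = x + (c1 + e1)"
  define Y where "Y = y + (c2 + e2)"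
  have "e1 + e2 \<le> rank X Y"
    unfolding rank_beyond[symmetric] X_def Y_def by (intro rank_mono) auto
  with assms have less: "k < rank X Y" by simp
  show ?thesis
  proof (cases "k < rank X y")
    case True
    with assms(1) obtain i where "i \<ge> x" "gap_col i y" "rank i y = k"
      using unit_step_crossing[of "\<lambda>i. rank i y" x k X "\<lambda>i. gap_col i y"]
      by (auto simp: rank_Suc_fst X_def)
    with gap_col_apery show ?thesis by metis
  next
    case False
    with less obtain j where "j \<ge> y" "gap_row X j" "rank X j = k"
      using unit_step_crossing[of "\<lambda>j. rank X j" y k Y "\<lambda>j. gap_row X j"]
      by (auto simp: rank_Suc_snd Y_def)
    moreover have "x \<le> X" by (simp add: X_def)
    ultimately show ?thesis using gap_row_apery order_trans by metis
  qed
qed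

text \<open>The alternatives are the two ways of being kept out of the level of rank
  \<open>k\<close>: not maximal, or the minimum of two elements of that level.\<close>

lemma apery_dominated:
  assumes A: "(x, y) \<in> S - E" and "rank x y < k" "k < e1 + e2"
  obtains x' y' where "x < x'" "y < y'" "(x', y') \<in> S - E" "rank x' y' = k"
  | x' y' where "x < x'" "(x', y) \<in> S - E" "rank x' y = k"
      "y < y'" "(x, y') \<in> S - E" "rank x y' = k"
proof (cases "rank (Suc x) (Suc y) \<le> k")
  case True
  from apery_of_rank[OF True assms(3)] show ?thesis
    using that(1) by (auto simp: Suc_le_eq)
next
  case False
  text \<open>The rank rises by two across the unit square at \<open>(x, y)\<close>, hence on each of its edges.\<close>
  have "rank (Suc x) (Suc y) = rank x y + of_bool (gap_col x y) + of_bool (gap_row (Suc x) y)"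
    by (simp only: rank_Suc_snd[of "Suc x"] rank_Suc_fst[of x y])
  moreover have "rank (Suc x) (Suc y) = rank x y + of_bool (gap_row x y) + of_bool (gap_col x (Suc y))"
    by (simp only: rank_Suc_fst[of x "Suc y"] rank_Suc_snd[of x y])
  ultimately have "gap_row (Suc x) y \<and> gap_col x (Suc y) \<and>
    rank (Suc x) y = k \<and> rank x (Suc y) = k"
    using False assms(2)
    by (simp add: rank_Suc_fst[of x y] rank_Suc_snd[of x y] of_bool_def split: if_splits)
  with gap_row_apery[of "Suc x" y] gap_col_apery[of x "Suc y"] that(2) show ?thesis
    by (metis Suc_le_eq)
qed

lemma rank_less_total: "(x, y) \<in> S - E \<Longrightarrow> rank x y < e1 + e2"
proof -
  assume "(x, y) \<in> S - E"
  \<comment> \<open>This point strictly dominates \<open>(x, y)\<close>, and subtracting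
    \<open>(e1, e2)\<close> leaves it beyond \<open>(c1, c2)\<close>.\<close>
  then have "rank x y < rank (c1 + e1 + Suc x) (c2 + e2 + Suc y)"
    by (rule rank_less) auto
  also have "\<dots> = len S (c1 + Suc x + e1) (c2 + Suc y + e2)
      - len E (e1 + (c1 + Suc x)) (e2 + (c2 + Suc y))"
    by (simp add: rank_def ac_simps)
  also have "\<dots> = e1 + e2"
    by (simp only: len_E_shift len_beyond_fst[OF le_add1] len_beyond_snd[OF le_add1])
  finally show ?thesis .
qed

text \<open>On row \<open>c2 + e2\<close> the rank climbs from \<open>e2\<close> to
  \<open>e1 + e2\<close>, so some column gap occurs at rank \<open>k\<close>. Higher up the rank
  stays constant because all rows meet \<open>E\<close>.\<close>

lemma vertical_line:
  assumes "e2 \<le> k" "k < e1 + e2"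
  shows "\<exists>x. \<forall>y\<ge>c2 + e2. (x, y) \<in> S - E \<and> rank x y = k"
proof -
  from assms obtain x where x: "gap_col x (c2 + e2)" "rank x (c2 + e2) = k"
    using unit_step_crossing[of "\<lambda>i. rank i (c2 + e2)" 0 k "c1 + e1" "\<lambda>i. gap_col i (c2 + e2)"]
    by (auto simp: rank_Suc_fst rank_beyond rank_first_col)
  have "(x, y) \<in> S - E \<and> rank x y = k" if y: "y \<ge> c2 + e2" for y
  proof -
    \<comment> \<open>All rows from \<open>c2\<close> on meet \<open>S\<close>, so
      \<open>hits_exchange\<close> carries the column hit from each height to the next.\<close>
    have "hits_col S x y" using y
    proof (induction y rule: dec_induct)
      case base
      with x show ?case by (simp add: gap_col_def)
    next
      case (step y)
      then show ?case using hits_exchange[of x y] by (simp add: hits_row_beyond of_bool_def split: if_splits)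
    qed
    then have "(x, y) \<in> S" using mem_if_hits hits_row_beyond y by simp
    moreover have "(x, y) \<notin> E" using x y by (auto simp: gap_col_def hits_col_def)
    ultimately show ?thesis using x rank_row_beyond[OF y] by simp
  qed
  then show ?thesis by blast
qed

lemma horizontal_line:
  assumes "e1 \<le> k" "k < e1 + e2"
  shows "\<exists>y. \<forall>x\<ge>c1 + e1. (x, y) \<in> S - E \<and> rank x y = k"
proof -
  interpret sw: apery_pair "prod.swap ` S" e2 e1 c2 c1 by (rule apery_pair_swap)
  show ?thesis using sw.vertical_line[of k] assms by (simp add: swap_rank swap_E add.commute)
qed

lemma snd_bounded_if_rank_less: "rank x y < e2 \<Longrightarrow> y < c2 + e2"
  using rank_mono[of 0 x "c2 + e2" y] by (force simp: rank_first_col not_le[symmetric])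

lemma fst_bounded_if_rank_less: "rank x y < e1 \<Longrightarrow> x < c1 + e1"
  using rank_mono[of "c1 + e1" x 0 y] by (force simp: rank_first_row not_le[symmetric])

section \<open>Levels are rank sets\<close>

definition ranked :: "nat \<Rightarrow> (nat \<times> nat) set" where
  "ranked k = {(x, y) \<in> S - E. rank x y = k}"

lemma ranked_iff: "(x, y) \<in> ranked k \<longleftrightarrow> (x, y) \<in> S - E \<and> rank x y = k"
  by (simp add: ranked_def)

lemma ranked_nonempty: "k < e1 + e2 \<Longrightarrow> ranked k \<noteq> {}"
  using apery_of_rank[of 0 0 k] by (auto simp: ranked_def)

lemma Union_ranked: "S - E = (\<Union>k<e1 + e2. ranked k)"
  using rank_less_total by (auto simp: ranked_def)

text \<open>Elements of rank \<open>k\<close> are maximal by \<open>rank_less\<close>; lower ones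
  are excluded by \<open>apery_dominated\<close>.\<close>

lemma D_part_ranked:
  assumes "k < e1 + e2"
  shows "D_part (\<Union>i\<le>k. ranked i) = ranked k"
proof -
  let ?X = "\<Union>i\<le>k. ranked i"
  have X: "(x, y) \<in> ?X \<longleftrightarrow> (x, y) \<in> S - E \<and> rank x y \<le> k" for x y
    by (auto simp: ranked_def)
  have top: "(x, y) \<in> B_part ?X" if "(x, y) \<in> ranked k" for x y
  proof -
    have xy: "(x, y) \<in> S - E" "rank x y = k" using that by (simp_all add: ranked_iff)
    have "\<not> ll (x, y) \<beta>" if "\<beta> \<in> ?X" for \<beta>
    proof
      assume "ll (x, y) \<beta>"
      then have "k < rank (fst \<beta>) (snd \<beta>)" using rank_less[OF xy(1)] xy(2) by (simp add: ll_def)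
      moreover have "rank (fst \<beta>) (snd \<beta>) \<le> k" using that X[of "fst \<beta>" "snd \<beta>"] by simp
      ultimately show False by simp
    qed
    with xy X[of x y] show ?thesis by (auto simp: B_part_def lele_def)
  qed
  show ?thesis
  proof (rule set_eqI, rule iffI)
    fix \<alpha> assume D: "\<alpha> \<in> D_part ?X"
    obtain x y where \<alpha>: "\<alpha> = (x, y)" by fastforce
    have B: "(x, y) \<in> B_part ?X" using D \<alpha> by (simp add: D_part_def)
    then have xy: "(x, y) \<in> S - E" "rank x y \<le> k" using X[of x y] by (auto simp: B_part_def)
    have "rank x y = k"
    proof (rule ccontr)
      assume "rank x y \<noteq> k"
      with xy have "rank x y < k" by simp
      from xy(1) this assms show False
      proof (cases rule: apery_dominated)
        case (1 x' y')
        then have "lele (x, y) (x', y')" "(x', y') \<in> ?X"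
          using X[of x' y'] by (auto simp: lele_def ll_def)
        with B 1 show False by (auto simp: B_part_def)
      next
        case (2 x' y')
        then have right: "(x', y) \<in> B_part ?X - {\<alpha>}" and above: "(x, y') \<in> B_part ?X - {\<alpha>}"
          using top \<alpha> by (auto simp: ranked_iff)
        have "\<alpha> = inf (x', y) (x, y')" using 2 \<alpha> by (simp add: inf_nat_def)
        with B have "\<alpha> \<in> C_part ?X"
          unfolding C_part_def \<alpha>[symmetric] by (intro CollectI conjI bexI[OF bexI[OF _ above] right])
        with D show False by (simp add: D_part_def)
      qed
    qed
    with xy \<alpha> show "\<alpha> \<in> ranked k" by (simp add: ranked_iff)
  next
    fix \<alpha> assume k: "\<alpha> \<in> ranked k"
    obtain x y where \<alpha>: "\<alpha> = (x, y)" by fastforce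
    have xy: "(x, y) \<in> S - E" "rank x y = k" using k \<alpha> by (simp_all add: ranked_iff)
    have "\<alpha> \<notin> C_part ?X"
    proof
      assume "\<alpha> \<in> C_part ?X"
      then obtain \<beta> \<gamma> where \<beta>\<gamma>: "\<beta> \<in> ?X" "\<gamma> \<in> ?X" "\<beta> \<noteq> \<alpha>" "\<gamma> \<noteq> \<alpha>" "\<alpha> = inf \<beta> \<gamma>"
        unfolding C_part_def B_part_def by blast
      obtain a b a' b' where "\<beta> = (a, b)" "\<gamma> = (a', b')" by fastforce
      with \<beta>\<gamma> have ab: "(a, b) \<in> ?X" "(a', b') \<in> ?X"
        and ne: "(a, b) \<noteq> \<alpha>" "(a', b') \<noteq> \<alpha>" and inf: "\<alpha> = inf (a, b) (a', b')" by simp_all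
      \<comment> \<open>One of the two points lies above \<open>(x + 1, y)\<close> and the other
        above \<open>(x, y + 1)\<close>. So neither unit step from \<open>(x, y)\<close> raises the
        rank, contrary to \<open>gap_if_apery\<close>.\<close>
      from ne inf \<alpha> have "(Suc x \<le> a \<and> y \<le> b \<and> x \<le> a' \<and> Suc y \<le> b') \<or>
          (Suc x \<le> a' \<and> y \<le> b' \<and> x \<le> a \<and> Suc y \<le> b)"
        by (auto simp: inf_nat_def min_def split: if_splits)
      then have "rank (Suc x) y \<le> k \<and> rank x (Suc y) \<le> k"
        using ab[unfolded X] rank_mono order_trans by meson
      with gap_if_apery[OF xy(1)] xy(2) show False by (auto simp: rank_Suc_fst rank_Suc_snd)
    qed
    with top k \<alpha> show "\<alpha> \<in> D_part ?X" by (simp add: D_part_def)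
  qed
qed

lemma finite_ranked:
  assumes "k < e1" "k < e2"
  shows "finite (ranked k)"
proof (rule finite_subset)
  show "ranked k \<subseteq> {..<c1 + e1} \<times> {..<c2 + e2}"
    using assms snd_bounded_if_rank_less fst_bounded_if_rank_less by (auto simp: ranked_def)
qed simp

context
  assumes Apery: "Apery S = S - E"
begin

text \<open>Levels are peeled off from the top rank: the first \<open>i - 1\<close> of them remove
  exactly the ranks above \<open>e1 + e2 - i\<close>.\<close>

lemma D_level_eq: "1 \<le> i \<Longrightarrow> i \<le> e1 + e2 \<Longrightarrow> D_level S i = ranked (e1 + e2 - i)"
proof (induction i rule: less_induct)
  case (less i)
  have "(\<Union>j\<in>{1..<i}. D_level S j) = (\<Union>j\<in>{1..<i}. ranked (e1 + e2 - j))"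
    using less by (intro SUP_cong) auto
  also have "\<dots> = (\<Union>k\<in>{e1 + e2 - i<..<e1 + e2}. ranked k)"
  proof -
    have "(\<lambda>j. e1 + e2 - j) ` {1..<i} = {e1 + e2 - i<..<e1 + e2}"
    proof (intro equalityI subsetI)
      fix k assume "k \<in> {e1 + e2 - i<..<e1 + e2}"
      then show "k \<in> (\<lambda>j. e1 + e2 - j) ` {1..<i}"
        by (intro image_eqI[of _ _ "e1 + e2 - k"]) auto
    qed (use less.prems in auto)
    from this[symmetric] show ?thesis by (simp only: image_image)
  qed
  finally have "Apery S - (\<Union>j\<in>{1..<i}. D_level S j) = (\<Union>k\<le>e1 + e2 - i. ranked k)"
    using less.prems unfolding Apery Union_ranked
    by (auto simp: ranked_def not_less)
  then show ?case using less.prems by (subst D_level.simps) (simp add: D_part_ranked)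
qed

lemma num_levels_eq: "num_levels S = e1 + e2"
  unfolding num_levels_def
proof (rule Least_equality)
  have "(\<Union>i\<in>{1..e1 + e2}. D_level S i) = (\<Union>i\<in>{1..e1 + e2}. ranked (e1 + e2 - i))"
    by (intro SUP_cong) (auto simp: D_level_eq)
  also have "\<dots> = (\<Union>k<e1 + e2. ranked k)"
  proof -
    have "(\<lambda>i. e1 + e2 - i) ` {1..e1 + e2} = {..<e1 + e2}"
    proof (intro equalityI subsetI)
      fix k assume "k \<in> {..<e1 + e2}"
      then show "k \<in> (\<lambda>i. e1 + e2 - i) ` {1..e1 + e2}"
        by (intro image_eqI[of _ _ "e1 + e2 - k"]) auto
    qed auto
    from this[symmetric] show ?thesis by (simp only: image_image)
  qed
  finally have "Apery S = (\<Union>i\<in>{1..e1 + e2}. D_level S i)"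
    unfolding Apery Union_ranked by simp
  moreover have "disjoint_family_on (D_level S) {1..e1 + e2}"
    unfolding disjoint_family_on_def by (auto simp: D_level_eq ranked_def)
  ultimately show "disjoint_family_on (D_level S) {1..e1 + e2} \<and>
      Apery S = (\<Union>i\<in>{1..e1 + e2}. D_level S i)" by blast
next
  fix N assume N: "disjoint_family_on (D_level S) {1..N} \<and> Apery S = (\<Union>i\<in>{1..N}. D_level S i)"
  show "e1 + e2 \<le> N"
  proof (rule ccontr)
    \<comment> \<open>Among the first \<open>e1 + e2\<close> levels only the last contains elements
      of rank 0, so fewer levels cannot cover the Apery set.\<close>
    assume less: "\<not> e1 + e2 \<le> N"
    then have "ranked 0 \<noteq> {}" by (intro ranked_nonempty) linarith
    then obtain \<alpha> where \<alpha>: "\<alpha> \<in> ranked 0" by blast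
    then have "\<alpha> \<in> Apery S" by (auto simp: Apery ranked_def)
    with N obtain i where "1 \<le> i" "i \<le> N" "\<alpha> \<in> D_level S i" by auto
    with less \<alpha> show False by (auto simp: D_level_eq ranked_def)
  qed
qed

lemma A_level_eq: "1 \<le> i \<Longrightarrow> i \<le> e1 + e2 \<Longrightarrow> A_level S i = ranked (i - 1)"
  by (simp add: A_level_def num_levels_eq D_level_eq)

lemma contains_line1_ranked:
  assumes "k < e1 + e2"
  shows "contains_line1 S (ranked k) \<longleftrightarrow> e2 \<le> k"
proof
  assume "contains_line1 S (ranked k)"
  then obtain a b where "Delta1 a b \<subseteq> ranked k" by (auto simp: contains_line1_def)
  \<comment> \<open>A point of the line high enough that its rank is at least
    \<open>e2\<close>.\<close>
  moreover have "(a, b + (c2 + e2) + 1) \<in> Delta1 a b" by (simp add: Delta1_def)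
  ultimately have "rank a (b + (c2 + e2) + 1) = k" by (auto simp: ranked_def)
  then show "e2 \<le> k" using snd_bounded_if_rank_less[of a "b + (c2 + e2) + 1"] by force
next
  assume "e2 \<le> k"
  with vertical_line assms obtain x where
    x: "\<And>y. y \<ge> c2 + e2 \<Longrightarrow> (x, y) \<in> S - E \<and> rank x y = k" by blast
  then have sub: "Delta1 x (c2 + e2) \<subseteq> ranked k" by (auto simp: Delta1_def ranked_def)
  have "(x, c2 + e2) \<in> S" using x by blast
  then have "x \<in> fst ` S" "c2 + e2 \<in> snd ` S" by force+
  moreover have "ranked k \<subseteq> Apery S" by (auto simp: Apery ranked_def)
  ultimately show "contains_line1 S (ranked k)"
    using sub unfolding contains_line1_def infinite_line1_def by blast
qed

lemma contains_line2_ranked: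
  assumes "k < e1 + e2"
  shows "contains_line2 S (ranked k) \<longleftrightarrow> e1 \<le> k"
proof
  assume "contains_line2 S (ranked k)"
  then obtain a b where "Delta2 a b \<subseteq> ranked k" by (auto simp: contains_line2_def)
  moreover have "(a + (c1 + e1) + 1, b) \<in> Delta2 a b" by (simp add: Delta2_def)
  ultimately have "rank (a + (c1 + e1) + 1) b = k" by (auto simp: ranked_def)
  then show "e1 \<le> k" using fst_bounded_if_rank_less[of "a + (c1 + e1) + 1" b] by force
next
  assume "e1 \<le> k"
  with horizontal_line assms obtain y where
    y: "\<And>x. x \<ge> c1 + e1 \<Longrightarrow> (x, y) \<in> S - E \<and> rank x y = k" by blast
  then have sub: "Delta2 (c1 + e1) y \<subseteq> ranked k" by (auto simp: Delta2_def ranked_def)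
  have "(c1 + e1, y) \<in> S" using y by blast
  then have "c1 + e1 \<in> fst ` S" "y \<in> snd ` S" by force+
  moreover have "ranked k \<subseteq> Apery S" by (auto simp: Apery ranked_def)
  ultimately show "contains_line2 S (ranked k)"
    using sub unfolding contains_line2_def infinite_line2_def by blast
qed

end

end

section \<open>Local good semigroups\<close>

context local_good_semigroup
begin

text \<open>The order is partial, so a least element has to be exhibited: the minimum of two nonzero
  elements, one with least first and one with least second coordinate. Locality keeps it
  nonzero.\<close>

lemma min_vec_mem: "min_vec S \<in> S"
proof -
  obtain c where "c + (1, 1) \<in> S" using G3 by blast
  moreover have "c + (1, 1) \<noteq> 0" by (auto simp: prod_eq_iff)
  ultimately have ne: "\<exists>\<alpha>. \<alpha> \<in> S - {0}" by blast
  obtain a where a: "a \<in> S - {0}" "\<And>\<alpha>. \<alpha> \<in> S - {0} \<Longrightarrow> fst a \<le> fst \<alpha>"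
    using ex_has_least_nat[of "\<lambda>\<alpha>. \<alpha> \<in> S - {0}" _ fst] ne by blast
  obtain b where b: "b \<in> S - {0}" "\<And>\<alpha>. \<alpha> \<in> S - {0} \<Longrightarrow> snd b \<le> snd \<alpha>"
    using ex_has_least_nat[of "\<lambda>\<alpha>. \<alpha> \<in> S - {0}" _ snd] ne by blast
  have pos: "fst \<alpha> \<noteq> 0" if "\<alpha> \<in> S - {0}" for \<alpha> using local[of \<alpha>] that by (metis DiffE singletonI)
  have "fst (inf a b) \<noteq> 0" using pos[OF a(1)] pos[OF b(1)] by (simp add: inf_nat_def min_def)
  then have "inf a b \<noteq> 0" by (metis fst_zero)
  then have "inf a b \<in> S - {0}" using G1 a(1) b(1) by blast
  moreover have "inf a b \<le> \<alpha>" if "\<alpha> \<in> S - {0}" for \<alpha>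
    using a(2)[OF that] b(2)[OF that] by (simp add: less_eq_prod_def inf_nat_def min.coboundedI1 min.coboundedI2)
  ultimately have "min_vec S = inf a b" unfolding min_vec_def by (intro Least_equality)
  with \<open>inf a b \<in> S - {0}\<close> show ?thesis by simp
qed

lemma apery_pair_min_vec:
  assumes "min_vec S = (e1, e2)"
  obtains c1 c2 where "apery_pair S e1 e2 c1 c2" "Apery S = S - apery_pair.E S e1 e2"
proof -
  obtain c where c: "\<And>\<gamma>. c + \<gamma> \<in> S" using G3 by blast
  interpret apery_pair S e1 e2 "fst c" "snd c"
  proof
    show "(min a a', min b b') \<in> S" if "(a, b) \<in> S" "(a', b') \<in> S" for a b a' b'
      using G1[OF that] by (simp add: inf_nat_def)
    show "\<exists>a'>a. (a', b) \<in> S" if "(a, b) \<in> S" "(a, b') \<in> S" "b < b'" for a b b'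
      using G2_fst[OF that(1,2)] that(3) by (auto simp: min_def)
    show "\<exists>b'>b. (a, b') \<in> S" if "(a, b) \<in> S" "(a', b) \<in> S" "a < a'" for a b a'
      using G2_snd[OF that(1,2)] that(3) by (auto simp: min_def)
    show "(e1 + a, e2 + b) \<in> S" if "(a, b) \<in> S" for a b
      using add_mem[OF min_vec_mem that] assms by simp
    show "(a, b) \<in> S" if "fst c \<le> a" "snd c \<le> b" for a b
      using c[of "(a - fst c, b - snd c)"] that by (cases c) simp
  qed
  have "(e1, e2) \<le> \<alpha> \<and> \<alpha> - (e1, e2) \<in> S \<longleftrightarrow> \<alpha> \<in> E" for \<alpha>
    using shifted_mem_E[of "fst \<alpha> - e1" "snd \<alpha> - e2"] E_ge[of "fst \<alpha>" "snd \<alpha>"]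
    by (cases \<alpha>) auto
  then have "Apery S = S - E" unfolding Apery_def assms by blast
  with apery_pair_axioms show ?thesis by (rule that)
qed

end

theorem theorem3p8:
  fixes S :: "(nat \<times> nat) set" and e1 e2 e :: nat
  assumes "local_good_semigroup S"
    and "(e1, e2) = min_vec S"
    and "e = e1 + e2"
  shows "(e1 \<ge> e2 \<longrightarrow>
            (\<forall>i\<in>{e - e2 + 1..e}. contains_two_infinite_lines S (A_level S i)) \<and>
            (\<forall>i\<in>{e - e1 + 1..e - e2}. contains_only_one_infinite_line S (A_level S i) \<and>
                                       contains_line1 S (A_level S i)) \<and>
            (\<forall>i\<in>{1..e - e1}. finite (A_level S i))) \<and>
         (e1 \<le> e2 \<longrightarrow>
            (\<forall>i\<in>{e - e1 + 1..e}. contains_two_infinite_lines S (A_level S i)) \<and>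
            (\<forall>i\<in>{e - e2 + 1..e - e1}. contains_only_one_infinite_line S (A_level S i) \<and>
                                       contains_line2 S (A_level S i)) \<and>
            (\<forall>i\<in>{1..e - e2}. finite (A_level S i)))"
proof -
  obtain c1 c2 where "apery_pair S e1 e2 c1 c2" and Ap: "Apery S = S - apery_pair.E S e1 e2"
    using local_good_semigroup.apery_pair_min_vec[OF assms(1) assms(2)[symmetric]] .
  then interpret apery_pair S e1 e2 c1 c2 by simp
  \<comment> \<open>Level \<open>i\<close> has rank \<open>i - 1\<close>, which turns
    \<open>e2 \<le> i - 1\<close> into \<open>e2 < i\<close>. All claims then compare
    \<open>i\<close> with \<open>e1\<close> and \<open>e2\<close>.\<close>
  have line1: "contains_line1 S (A_level S i) \<longleftrightarrow> e2 < i"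
    and line2: "contains_line2 S (A_level S i) \<longleftrightarrow> e1 < i"
    and fin: "i \<le> e1 \<Longrightarrow> i \<le> e2 \<Longrightarrow> finite (A_level S i)"
    if "1 \<le> i" "i \<le> e1 + e2" for i
    using that contains_line1_ranked[OF Ap, of "i - 1"] contains_line2_ranked[OF Ap, of "i - 1"]
      finite_ranked[of "i - 1"] by (auto simp: A_level_eq[OF Ap])
  show ?thesis
    unfolding assms(3) contains_two_infinite_lines_def contains_only_one_infinite_line_def
    using line1 line2 fin by auto
qed

end
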